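(* Let $G$ be a finitely generated group with $\mathrm{gen}(G)=n$. Then $$\mathrm{gen}(\mathrm{Core}(G))\ \leq\ 2^n.$$ More sharply, if $N$ is the (normal) subgroup of $G$ generated by all squares of elements of $G$, and $\mathrm{gen}(G/N)=m\leq n$, then $$\mathrm{gen}(\mathrm{Core}(G))\ \leq\ \bigl(1+n+n(n-1)/2\bigr)+2^m-\bigl(1+m+m(m-1)/2\bigr).$$ Namely, if $\{g_1,\dots,g_n\}$ is a generating set for the group $G$ such that the images in $G/N$ of $g_1,\dots,g_m$ generate $G/N$, while $g_{m+1},\dots,g_n\in N$, then a generating set $X$ for the quandle $\mathrm{Core}(G)$ whose cardinality is the right-hand side of the last inequality is given by the set of those products $g_{i_1}\cdots g_{i_k}$ (including the empty product $1$, with $k=0$) such that $i_1<\dots<i_k$, and either $i_k\leq m$ or $k\leq 2$.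
   Context: An involutory quandle is a set $Q$ with a binary operation $\lhd$ such that for all $x,y,z\in Q$: $x\lhd x=x$; $x\lhd(x\lhd y)=y$; and $x\lhd(y\lhd z)=(x\lhd y)\lhd(x\lhd z)$. For a group $G$, $\mathrm{Core}(G)$ is the involutory quandle with the same underlying set as $G$ and operation $x\lhd y=xy^{-1}x$. For a group $G$, $\mathrm{gen}(G)$ denotes the minimum number of elements needed to generate $G$ as a group; for an involutory quandle $Q$, $\mathrm{gen}(Q)$ denotes the minimum number of elements needed to generate $Q$ as a quandle (i.e., the least cardinality of a subset of $Q$ whose closure under $\lhd$ is all of $Q$). *)

theory Defs
  imports "HOL-Algebra.Algebra" "HOL-Library.Extended_Nat"
begin

record 'a quandle = "'a partial_object" +
  qop :: "'a \<Rightarrow> 'a \<Rightarrow> 'a"  (infixl \<open>\<lhd>\<^sub>q\<index>\<close> 70)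

locale involutory_quandle =
  fixes Q (structure)
  assumes closed: "\<lbrakk>x \<in> carrier Q; y \<in> carrier Q\<rbrakk> \<Longrightarrow> x \<lhd>\<^sub>q y \<in> carrier Q"
    and idem: "x \<in> carrier Q \<Longrightarrow> x \<lhd>\<^sub>q x = x"
    and invol: "\<lbrakk>x \<in> carrier Q; y \<in> carrier Q\<rbrakk> \<Longrightarrow> x \<lhd>\<^sub>q (x \<lhd>\<^sub>q y) = y"
    and distrib: "\<lbrakk>x \<in> carrier Q; y \<in> carrier Q; z \<in> carrier Q\<rbrakk>
      \<Longrightarrow> x \<lhd>\<^sub>q (y \<lhd>\<^sub>q z) = (x \<lhd>\<^sub>q y) \<lhd>\<^sub>q (x \<lhd>\<^sub>q z)"

definition Core :: "('a, 'b) monoid_scheme \<Rightarrow> 'a quandle" where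
  "Core G = \<lparr>carrier = carrier G, qop = (\<lambda>x y. x \<otimes>\<^bsub>G\<^esub> inv\<^bsub>G\<^esub> y \<otimes>\<^bsub>G\<^esub> x)\<rparr>"

inductive_set quandle_closure :: "('a, 'b) quandle_scheme \<Rightarrow> 'a set \<Rightarrow> 'a set"
  for Q and S where
    incl: "x \<in> S \<Longrightarrow> x \<in> quandle_closure Q S"
  | op: "\<lbrakk>x \<in> quandle_closure Q S; y \<in> quandle_closure Q S\<rbrakk>
      \<Longrightarrow> x \<lhd>\<^sub>q\<^bsub>Q\<^esub> y \<in> quandle_closure Q S"

definition generates_quandle :: "('a, 'b) quandle_scheme \<Rightarrow> 'a set \<Rightarrow> bool" where
  "generates_quandle Q S \<longleftrightarrow> S \<subseteq> carrier Q \<and> quandle_closure Q S = carrier Q"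

definition generates_group :: "('a, 'b) monoid_scheme \<Rightarrow> 'a set \<Rightarrow> bool" where
  "generates_group G S \<longleftrightarrow> S \<subseteq> carrier G \<and> generate G S = carrier G"

text \<open>Unlike \<^const>\<open>card\<close>, this does not give infinite sets the value 0.\<close>
definition ecard :: "'a set \<Rightarrow> enat" where
  "ecard S = (if finite S then enat (card S) else \<infinity>)"

text \<open>
  The value is \<^term>\<open>\<infinity>\<close> exactly when there is no finite generating set, so that
  \<open>gen_group G = enat n\<close> includes that \<open>G\<close> is finitely generated, and an inequality
  \<open>gen_quandle Q \<le> enat k\<close> includes that \<open>Q\<close> is.
\<close>
definition gen_group :: "('a, 'b) monoid_scheme \<Rightarrow> enat" where
  "gen_group G = (INF S \<in> {S. generates_group G S}. ecard S)"

definition gen_quandle :: "('a, 'b) quandle_scheme \<Rightarrow> enat" where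
  "gen_quandle Q = (INF S \<in> {S. generates_quandle Q S}. ecard S)"

definition squares_subgroup :: "('a, 'b) monoid_scheme \<Rightarrow> 'a set" where
  "squares_subgroup G = generate G {x \<otimes>\<^bsub>G\<^esub> x | x. x \<in> carrier G}"

text \<open>The products \<open>g i\<^sub>1 \<otimes> \<dots> \<otimes> g i\<^sub>k\<close> with \<open>1 \<le> i\<^sub>1 < \<dots> < i\<^sub>k \<le> n\<close> and either \<open>i\<^sub>k \<le> m\<close>
  or \<open>k \<le> 2\<close>; the list \<open>is\<close> is \<open>[i\<^sub>1, \<dots>, i\<^sub>k]\<close>. For \<open>k = 0\<close>, where \<^term>\<open>last is\<close> is
  unspecified, the second alternative holds.\<close>
definition core_gens :: "('a, 'b) monoid_scheme \<Rightarrow> nat \<Rightarrow> nat \<Rightarrow> (nat \<Rightarrow> 'a) \<Rightarrow> 'a set" where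
  "core_gens G n m g =
    {foldr (\<otimes>\<^bsub>G\<^esub>) (map g is) \<one>\<^bsub>G\<^esub> | is.
      set is \<subseteq> {1..n} \<and> sorted_wrt (<) is \<and> (last is \<le> m \<or> length is \<le> 2)}"

text \<open>Neither the subtraction nor the divisions truncate, by \<open>real_core_gen_bound\<close> below.\<close>
definition core_gen_bound :: "nat \<Rightarrow> nat \<Rightarrow> nat" where
  "core_gen_bound n m = (1 + n + n * (n - 1) div 2) + 2 ^ m - (1 + m + m * (m - 1) div 2)"

lemma real_core_gen_bound:
  "real (core_gen_bound n m) =
    (1 + real n + real n * (real n - 1) / 2) + 2 ^ m - (1 + real m + real m * (real m - 1) / 2)"
proof -
  have half: "real (k * (k - 1) div 2) = real k * (real k - 1) / 2" for k :: nat
    by (cases k) (simp_all add: real_of_nat_div algebra_simps)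
  have "1 + m + m * (m - 1) div 2 \<le> 2 ^ m"
  proof (induction m)
    case (Suc m)
    have "Suc m * (Suc m - 1) div 2 = m * (m - 1) div 2 + m"
    proof -
      have "Suc m * (Suc m - 1) = m * (m - 1) + m * 2"
        by (cases m) simp_all
      then show ?thesis by simp
    qed
    moreover have "Suc m \<le> 2 ^ m"
      by (simp add: Suc_leI)
    ultimately show ?case using Suc.IH by simp
  qed simp
  then have le: "1 + m + m * (m - 1) div 2 \<le> (1 + n + n * (n - 1) div 2) + 2 ^ m"
    by (rule trans_le_add2)
  show ?thesis
    unfolding core_gen_bound_def of_nat_diff[OF le] by (simp only: of_nat_add half) simp
qed

lemma (in group) involutory_quandle_Core: "involutory_quandle (Core G)"
proof -
  have cancel: "x \<otimes> (inv x \<otimes> y) = y" "inv x \<otimes> (x \<otimes> y) = y"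
    if "x \<in> carrier G" "y \<in> carrier G" for x y
    using that by (simp_all flip: m_assoc)
  show ?thesis
    by unfold_locales (simp_all add: Core_def m_assoc inv_mult_group cancel)
qed

lemma (in group) squares_subgroup_normal: "squares_subgroup G \<lhd> G"
  unfolding squares_subgroup_def
proof (rule normal_generateI)
  show "{x \<otimes> x | x. x \<in> carrier G} \<subseteq> carrier G" by auto
next
  fix h g assume "h \<in> {x \<otimes> x | x. x \<in> carrier G}" and g: "g \<in> carrier G"
  then obtain x where x: "x \<in> carrier G" and h: "h = x \<otimes> x" by auto
  have "g \<otimes> h \<otimes> inv g = (g \<otimes> x \<otimes> inv g) \<otimes> (g \<otimes> x \<otimes> inv g)"
    using x g by (simp add: h m_assoc inv_solve_left)
  then show "g \<otimes> h \<otimes> inv g \<in> {x \<otimes> x | x. x \<in> carrier G}"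
    using x g by blast
qed

end

theory Submission
  imports Defs
begin

text \<open>
  Let \<open>Q\<close> be the subquandle generated by the given products. Since \<open>1 \<in> Q\<close>, the map
  \<open>a \<mapsto> x a x\<close> preserves \<open>Q\<close> for every \<open>x \<in> Q\<close>. Hence the stabilizer \<open>L\<close> of \<open>Q\<close> under left
  translations is normalized by \<open>Q\<close>, so it is normal in \<open>G\<close>. When \<open>x\<close>, \<open>y\<close> and \<open>x y\<close> lie in
  \<open>Q\<close>, composing \<open>a \<mapsto> (x y) a (x y)\<close> with the inverses of the maps for \<open>x\<close> and \<open>y\<close> gives the
  left translation by \<open>x y x\<^sup>-\<^sup>1 y\<^sup>-\<^sup>1\<close>; as \<open>Q\<close> contains the products of two generators, \<open>G / L\<close> is
  abelian. Then \<open>x\<^sup>2 a\<close> and \<open>x a x \<in> Q\<close> agree modulo \<open>L\<close>, so \<open>L\<close> contains the squares of the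
  generators and therefore \<open>N\<close>. Thus \<open>Q\<close> is a union of cosets of \<open>N\<close>, and it meets all of
  them because \<open>G / N\<close> is an elementary abelian \<open>2\<close>-group generated by \<open>g\<^sub>1, \<dots>, g\<^sub>m\<close>.
\<close>

section \<open>Translation stabilizers\<close>

text \<open>Together with \<open>m_assoc\<close> this lets the simplifier compare words in a group:
  products are nested to the right and adjacent inverses cancel.\<close>

lemma (in group) m_inv_cancel [simp]:
  assumes "x \<in> carrier G" "y \<in> carrier G"
  shows "x \<otimes> (inv x \<otimes> y) = y" "inv x \<otimes> (x \<otimes> y) = y"
  using assms by (simp_all flip: m_assoc)

text \<open>Both \<open>h\<close> and its inverse must map \<open>Q\<close> into itself: for
  infinite \<open>Q\<close>, invariance under \<open>h\<close> alone would not give a set closed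
  under inverses.\<close>

definition translation_stabilizer :: "('a, 'b) monoid_scheme \<Rightarrow> 'a set \<Rightarrow> 'a set" where
  "translation_stabilizer G Q =
    {h \<in> carrier G. \<forall>q\<in>Q. h \<otimes>\<^bsub>G\<^esub> q \<in> Q \<and> inv\<^bsub>G\<^esub> h \<otimes>\<^bsub>G\<^esub> q \<in> Q}"

lemma (in group) subgroup_translation_stabilizer:
  assumes "Q \<subseteq> carrier G"
  shows "subgroup (translation_stabilizer G Q) G"
proof (rule subgroupI)
  show "translation_stabilizer G Q \<subseteq> carrier G" "translation_stabilizer G Q \<noteq> {}"
    using assms by (auto simp: translation_stabilizer_def intro!: exI[of _ \<one>])
  fix a b
  assume a: "a \<in> translation_stabilizer G Q"
  then show "inv a \<in> translation_stabilizer G Q"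
    by (simp add: translation_stabilizer_def)
  assume b: "b \<in> translation_stabilizer G Q"
  have "(a \<otimes> b) \<otimes> q \<in> Q \<and> inv (a \<otimes> b) \<otimes> q \<in> Q" if "q \<in> Q" for q
  proof -
    have "(a \<otimes> b) \<otimes> q = a \<otimes> (b \<otimes> q)" "inv (a \<otimes> b) \<otimes> q = inv b \<otimes> (inv a \<otimes> q)"
      using a b that assms
      by (auto simp: translation_stabilizer_def m_assoc inv_mult_group)
    then show ?thesis
      using a b that by (simp add: translation_stabilizer_def)
  qed
  then show "a \<otimes> b \<in> translation_stabilizer G Q"
    using a b by (simp add: translation_stabilizer_def)
qed

text \<open>Both conjugations are assumed for generators, since for infinite \<open>H\<close> the
  inclusion of \<open>x H x^-1\<close> in \<open>H\<close> need not be an equality.\<close>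

lemma (in group) generate_conj_closed:
  assumes H: "subgroup H G" and S: "S \<subseteq> carrier G"
    and conj: "\<And>x h. \<lbrakk>x \<in> S; h \<in> H\<rbrakk> \<Longrightarrow> x \<otimes> h \<otimes> inv x \<in> H \<and> inv x \<otimes> h \<otimes> x \<in> H"
    and "x \<in> generate G S" "h \<in> H"
  shows "x \<otimes> h \<otimes> inv x \<in> H"
  using assms(4,5)
proof (induction arbitrary: h)
  case one
  then show ?case
    using subgroup.mem_carrier[OF H] by simp
next
  case (inv s)
  then show ?case
    using S conj by auto
next
  case (eng x y)
  have "x \<in> carrier G" "y \<in> carrier G" "h \<in> carrier G"
    using eng.hyps eng.prems generate_in_carrier[OF S] subgroup.mem_carrier[OF H] by auto
  then have "x \<otimes> y \<otimes> h \<otimes> inv (x \<otimes> y) = x \<otimes> (y \<otimes> h \<otimes> inv y) \<otimes> inv x"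
    by (simp add: m_assoc inv_mult_group)
  then show ?case
    using eng by simp
qed (use conj in blast)

lemma (in group) generate_commute:
  assumes S: "S \<subseteq> carrier G" and c: "c \<in> carrier G"
    and comm: "\<And>s. s \<in> S \<Longrightarrow> s \<otimes> c = c \<otimes> s"
    and "x \<in> generate G S"
  shows "x \<otimes> c = c \<otimes> x"
  using assms(4)
proof induction
  case (inv s)
  then have s: "s \<in> carrier G" "s \<otimes> c = c \<otimes> s"
    using S comm by auto
  then have "inv s \<otimes> c = inv s \<otimes> (c \<otimes> s) \<otimes> inv s"
    using c by (simp add: m_assoc)
  also have "\<dots> = c \<otimes> inv s"
    using s c by (simp flip: s(2) add: m_assoc)
  finally show ?case .
next
  case (eng x y)
  then have "x \<in> carrier G" "y \<in> carrier G"
    using generate_in_carrier[OF S] by auto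
  then show ?case
    using eng.IH c by (metis m_assoc)
qed (use c comm in auto)

lemma (in group) comm_group_if_generators_commute:
  assumes gen: "generates_group G S"
    and comm: "\<And>s t. \<lbrakk>s \<in> S; t \<in> S\<rbrakk> \<Longrightarrow> s \<otimes> t = t \<otimes> s"
  shows "comm_group G"
proof (rule group_comm_groupI)
  fix x y assume xy: "x \<in> carrier G" "y \<in> carrier G"
  have S: "S \<subseteq> carrier G" and eq: "carrier G = generate G S"
    using gen by (auto simp: generates_group_def)
  \<comment> \<open>Commutation is extended one argument at a time: first a generator against any
    \<open>y\<close>, then any \<open>x\<close> against \<open>y\<close>.\<close>
  have "s \<otimes> y = y \<otimes> s" if "s \<in> S" for s
    using generate_commute[OF S, of s y] comm that xy eq S by force
  then show "x \<otimes> y = y \<otimes> x"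
    using generate_commute[OF S, of y x] xy eq by blast
qed

text \<open>Squaring is an endomorphism of an abelian group, so its kernel is everything once it
  contains the generators.\<close>

lemma (in comm_group) square_one_if_generators:
  assumes gen: "generates_group G S"
    and sq: "\<And>s. s \<in> S \<Longrightarrow> s \<otimes> s = \<one>"
    and x: "x \<in> carrier G"
  shows "x \<otimes> x = \<one>"
proof -
  have S: "S \<subseteq> carrier G" and "x \<in> generate G S"
    using gen x by (auto simp: generates_group_def)
  from this(2) show ?thesis
  proof induction
    case (inv s)
    then show ?case
      using S sq by (metis inv_mult_group inv_one subset_eq)
  next
    case (eng x y)
    then have "x \<in> carrier G" "y \<in> carrier G"
      using generate_in_carrier[OF S] by auto
    then have "x \<otimes> y \<otimes> (x \<otimes> y) = (x \<otimes> x) \<otimes> (y \<otimes> y)"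
      by (simp add: m_ac)
    then show ?case
      using eng.IH by simp
  qed (use sq in auto)
qed

section \<open>Factor groups, and squares in the translation stabilizer\<close>

lemma (in normal) rcos_eq_iff:
  assumes "x \<in> carrier G" "y \<in> carrier G"
  shows "H #> x = H #> y \<longleftrightarrow> x \<otimes> inv y \<in> H"
  using assms repr_independence[of x H y] rcos_self[of x H] rcos_module[of y x]
  by (metis is_group is_subgroup)

lemma (in normal) hom_rcos: "group_hom G (G Mod H) (\<lambda>x. H #> x)"
  by (simp add: group_hom_def group_hom_axioms_def factorgroup_is_group is_group r_coset_hom_Mod)

lemma (in group) generates_group_Mod:
  assumes "L \<lhd> G" and gen: "generates_group G S"
  shows "generates_group (G Mod L) ((\<lambda>x. L #> x) ` S)"
proof -
  interpret group_hom G "G Mod L" "\<lambda>x. L #> x"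
    by (rule normal.hom_rcos[OF assms(1)])
  show ?thesis
    using gen generate_img[of S] by (auto simp: generates_group_def carrier_FactGroup)
qed

text \<open>One of the two products in \<open>prods\<close> is enough, because the equation
  \<open>L #> (x \<otimes> y) = L #> (y \<otimes> x)\<close> is symmetric in \<open>x\<close> and
  \<open>y\<close>.\<close>

lemma (in group) squares_subgroup_le_translation_stabilizer:
  assumes Q: "Q \<subseteq> carrier G"
    and op: "\<And>x y. \<lbrakk>x \<in> Q; y \<in> Q\<rbrakk> \<Longrightarrow> x \<otimes> inv y \<otimes> x \<in> Q"
    and one: "\<one> \<in> Q"
    and gen: "generates_group G S" and S: "S \<subseteq> Q"
    and prods: "\<And>x y. \<lbrakk>x \<in> S; y \<in> S\<rbrakk> \<Longrightarrow> x \<otimes> y \<in> Q \<or> y \<otimes> x \<in> Q"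
  shows "squares_subgroup G \<subseteq> translation_stabilizer G Q"
proof -
  define L where "L = translation_stabilizer G Q"
  have L: "subgroup L G"
    unfolding L_def by (rule subgroup_translation_stabilizer[OF Q])
  have L_mult: "h \<otimes> q \<in> Q" if "h \<in> L" "q \<in> Q" for h q
    using that by (simp add: L_def translation_stabilizer_def)
  have carr: "x \<in> carrier G" if "x \<in> Q" for x
    using that Q by blast
  have inv: "inv x \<in> Q" if "x \<in> Q" for x
    using op[OF one that] carr[OF that] by simp
  \<comment> \<open>This is the core operation of \<open>x\<close> on \<open>inv q\<close>. Every
    translation below is written as a composite of such two-sided maps.\<close>
  have sand: "x \<otimes> (q \<otimes> x) \<in> Q" if "x \<in> Q" "q \<in> Q" for x q
    using op[OF that(1) inv[OF that(2)]] carr that by (simp add: m_assoc)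
  have L_mult_right: "q \<otimes> h \<in> Q" if h: "h \<in> L" and q: "q \<in> Q" for h q
  proof -
    have "q \<otimes> h = inv (inv h \<otimes> inv q)"
      using subgroup.mem_carrier[OF L h] carr[OF q] by (simp add: inv_mult_group)
    then show ?thesis
      using inv L_mult subgroup.m_inv_closed[OF L h] q by simp
  qed
  have conj: "x \<otimes> h \<otimes> inv x \<in> L" if x: "x \<in> Q" and h: "h \<in> L" for x h
  proof -
    note hx = subgroup.mem_carrier[OF L h] carr[OF x]
    have *: "x \<otimes> k \<otimes> inv x \<otimes> q \<in> Q" if k: "k \<in> L" and q: "q \<in> Q" for k q
    proof -
      \<comment> \<open>Sandwich \<open>q\<close> by \<open>inv x\<close>, translate by
        \<open>k\<close>, sandwich by \<open>x\<close>: the two factors that accumulate on the right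
        cancel.\<close>
      have "x \<otimes> k \<otimes> inv x \<otimes> q = x \<otimes> ((k \<otimes> (inv x \<otimes> (q \<otimes> inv x))) \<otimes> x)"
        using hx carr[OF q] subgroup.mem_carrier[OF L k] by (simp add: m_assoc)
      then show ?thesis
        using sand[OF inv[OF x] q] L_mult[OF k] sand[OF x] by simp
    qed
    have "inv (x \<otimes> h \<otimes> inv x) = x \<otimes> inv h \<otimes> inv x"
      using hx by (simp add: inv_mult_group m_assoc)
    then show ?thesis
      using *[OF h] *[OF subgroup.m_inv_closed[OF L h]] hx
      unfolding L_def translation_stabilizer_def by simp
  qed
  have normal: "L \<lhd> G"
  proof (rule normal_invI[OF L])
    fix x h assume "x \<in> carrier G" "h \<in> L"
    \<comment> \<open>The second conjugate is \<open>conj\<close> applied to \<open>inv x\<close>,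
      which also lies in \<open>Q\<close>.\<close>
    moreover have "x \<otimes> h \<otimes> inv x \<in> L \<and> inv x \<otimes> h \<otimes> x \<in> L" if "x \<in> S" "h \<in> L" for x h
      using conj[of x h] conj[of "inv x" h] inv[of x] that S carr by force
    ultimately show "x \<otimes> h \<otimes> inv x \<in> L"
      using generate_conj_closed[OF L, of S] gen by (simp add: generates_group_def)
  qed
  interpret normal L G
    by (rule normal)
  interpret M: group "G Mod L"
    by (rule factorgroup_is_group)
  have commutator: "x \<otimes> y \<otimes> inv (y \<otimes> x) \<in> L"
    if x: "x \<in> Q" and y: "y \<in> Q" and xy: "x \<otimes> y \<in> Q" for x y
  proof -
    note xyc = carr[OF x] carr[OF y]
    have "x \<otimes> y \<otimes> inv (y \<otimes> x) \<otimes> q \<in> Q \<and> inv (x \<otimes> y \<otimes> inv (y \<otimes> x)) \<otimes> q \<in> Q"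
      if q: "q \<in> Q" for q
    proof
      \<comment> \<open>Sandwich by \<open>inv y\<close>, by \<open>inv x\<close> and then by
        \<open>x \<otimes> y\<close>; the right-hand factors cancel and the commutator remains on
        the left. For its inverse, the sandwiches are by \<open>inv (x \<otimes> y)\<close>,
        \<open>x\<close> and \<open>y\<close>.\<close>
      have "x \<otimes> y \<otimes> inv (y \<otimes> x) \<otimes> q =
          (x \<otimes> y) \<otimes> ((inv x \<otimes> ((inv y \<otimes> (q \<otimes> inv y)) \<otimes> inv x)) \<otimes> (x \<otimes> y))"
        using xyc carr[OF q] by (simp add: m_assoc inv_mult_group)
      then show "x \<otimes> y \<otimes> inv (y \<otimes> x) \<otimes> q \<in> Q"
        using x y xy q by (simp add: sand inv)
      have "inv (x \<otimes> y \<otimes> inv (y \<otimes> x)) \<otimes> q =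
          y \<otimes> ((x \<otimes> ((inv (x \<otimes> y) \<otimes> (q \<otimes> inv (x \<otimes> y))) \<otimes> x)) \<otimes> y)"
        using xyc carr[OF q] by (simp add: m_assoc inv_mult_group)
      then show "inv (x \<otimes> y \<otimes> inv (y \<otimes> x)) \<otimes> q \<in> Q"
        using sand[OF y] sand[OF x] sand[OF inv[OF xy] q] by simp
    qed
    moreover have "x \<otimes> y \<otimes> inv (y \<otimes> x) \<in> carrier G"
      using xyc by simp
    ultimately show ?thesis
      unfolding L_def translation_stabilizer_def by blast
  qed
  have genM: "generates_group (G Mod L) ((\<lambda>x. L #> x) ` S)"
    by (rule generates_group_Mod[OF normal gen])
  interpret M: comm_group "G Mod L"
  proof (rule M.comm_group_if_generators_commute[OF genM], clarify)
    fix x y assume xy: "x \<in> S" "y \<in> S"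
    have xyQ: "x \<in> Q" "y \<in> Q"
      using xy S by auto
    note xyc = carr[OF xyQ(1)] carr[OF xyQ(2)]
    have "L #> (x \<otimes> y) = L #> (y \<otimes> x)"
      using prods[OF xy]
    proof
      assume "x \<otimes> y \<in> Q"
      with commutator xyQ have "x \<otimes> y \<otimes> inv (y \<otimes> x) \<in> L" by blast
      with xyc show ?thesis by (subst rcos_eq_iff) simp_all
    next
      assume "y \<otimes> x \<in> Q"
      with commutator xyQ have "y \<otimes> x \<otimes> inv (x \<otimes> y) \<in> L" by blast
      with xyc show ?thesis by (subst eq_commute, subst rcos_eq_iff) simp_all
    qed
    then show "(L #> x) \<otimes>\<^bsub>G Mod L\<^esub> (L #> y) = (L #> y) \<otimes>\<^bsub>G Mod L\<^esub> (L #> x)"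
      using xyc by (simp add: rcos_sum)
  qed
  have rcos_comm: "L #> (x \<otimes> y) = L #> (y \<otimes> x)" if "x \<in> carrier G" "y \<in> carrier G" for x y
    using M.m_comm[of "L #> x" "L #> y"] that by (simp add: carrier_FactGroup rcos_sum)
  have sq_mult: "x \<otimes> x \<otimes> q \<in> Q" if x: "x \<in> Q" and q: "q \<in> Q" for x q
  proof -
    \<comment> \<open>\<open>h\<close> is the left factor carrying \<open>x q x\<close> to
      \<open>x x q\<close>. It is the conjugate by \<open>x\<close> of a commutator, hence lies in
      \<open>L\<close>.\<close>
    define h where "h = x \<otimes> x \<otimes> q \<otimes> inv (x \<otimes> (q \<otimes> x))"
    have "h = x \<otimes> (x \<otimes> q \<otimes> inv (q \<otimes> x)) \<otimes> inv x"
      using carr x q by (simp add: h_def m_assoc inv_mult_group)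
    moreover have "x \<otimes> q \<otimes> inv (q \<otimes> x) \<in> L"
      using rcos_comm[of x q] carr x q by (simp add: rcos_eq_iff)
    ultimately have "h \<in> L"
      using conj[OF x] by simp
    moreover have "x \<otimes> x \<otimes> q = h \<otimes> (x \<otimes> (q \<otimes> x))"
      using carr x q by (simp add: h_def m_assoc inv_mult_group)
    ultimately show ?thesis
      using L_mult sand[OF x q] by simp
  qed
  have sq: "x \<otimes> x \<in> L" if x: "x \<in> S" for x
  proof -
    have xQ: "x \<in> Q" using x S by blast
    have "inv (x \<otimes> x) = inv x \<otimes> inv x"
      using carr[OF xQ] by (simp add: inv_mult_group)
    moreover have "x \<otimes> x \<in> carrier G"
      using carr[OF xQ] by simp
    ultimately show ?thesis
      using sq_mult[OF xQ] sq_mult[OF inv[OF xQ]]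
      unfolding L_def translation_stabilizer_def by auto
  qed
  \<comment> \<open>Since the factor group is abelian, trivial squares of the generators give
    trivial squares everywhere.\<close>
  have "(L #> x) \<otimes>\<^bsub>G Mod L\<^esub> (L #> x) = \<one>\<^bsub>G Mod L\<^esub>" if "x \<in> carrier G" for x
  proof (rule M.square_one_if_generators[OF genM], clarify)
    fix s assume "s \<in> S"
    then show "(L #> s) \<otimes>\<^bsub>G Mod L\<^esub> (L #> s) = \<one>\<^bsub>G Mod L\<^esub>"
      using sq S carr by (simp add: rcos_sum subset_iff coset_join2 L)
  qed (use that in \<open>simp add: carrier_FactGroup\<close>)
  then have "x \<otimes> x \<in> L" if "x \<in> carrier G" for x
    using that by (simp add: rcos_sum coset_join1[OF _ _ L])
  then show ?thesis
    unfolding squares_subgroup_def L_def[symmetric]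
    by (intro generate_subgroup_incl[OF _ L]) auto
qed

section \<open>Products over sets of indices\<close>

text \<open>A strictly increasing list is determined by its set of entries. Indexing the products by
  finite sets turns their enumeration into counting subsets.\<close>

definition index_prod :: "('a, 'b) monoid_scheme \<Rightarrow> ('i::linorder \<Rightarrow> 'a) \<Rightarrow> 'i set \<Rightarrow> 'a" where
  "index_prod G g A = foldr (\<otimes>\<^bsub>G\<^esub>) (map g (sorted_list_of_set A)) \<one>\<^bsub>G\<^esub>"

definition core_index_sets :: "nat \<Rightarrow> nat \<Rightarrow> nat set set" where
  "core_index_sets n m = {A. A \<subseteq> {1..n} \<and> (A \<subseteq> {1..m} \<or> card A \<le> 2)}"

lemma core_gens_conv_index_prod: "core_gens G n m g = index_prod G g ` core_index_sets n m"
proof -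
  have last_le: "last is \<le> m \<longleftrightarrow> (\<forall>i\<in>set is. i \<le> m)" if "sorted_wrt (<) is" "is \<noteq> []" for "is" :: "nat list"
    using that by (cases "is" rule: rev_cases) (auto simp: sorted_wrt_append)
  \<comment> \<open>For the empty list both sides hold by the size alternative, so the unspecified
    value of \<open>last []\<close> does no harm.\<close>
  have cond: "last is \<le> m \<or> length is \<le> 2 \<longleftrightarrow> set is \<subseteq> {1..m} \<or> card (set is) \<le> 2"
    if "sorted_wrt (<) is" "set is \<subseteq> {1..n}" for "is"
  proof -
    have "card (set is) = length is"
      using that(1) by (simp add: distinct_card strict_sorted_iff)
    then show ?thesis
      using last_le[OF that(1)] that(2) by (cases "is = []") auto
  qed
  show ?thesis
  proof (intro subset_antisym subsetI)
    fix x assume "x \<in> core_gens G n m g"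
    then obtain "is" where "is": "set is \<subseteq> {1..n}" "sorted_wrt (<) is"
        "last is \<le> m \<or> length is \<le> 2" "x = foldr (\<otimes>\<^bsub>G\<^esub>) (map g is) \<one>\<^bsub>G\<^esub>"
      by (auto simp: core_gens_def)
    then have "x = index_prod G g (set is)"
      by (simp add: index_prod_def sorted_list_of_set.idem_if_sorted_distinct strict_sorted_iff)
    moreover have "set is \<in> core_index_sets n m"
      using "is" cond by (simp add: core_index_sets_def)
    ultimately show "x \<in> index_prod G g ` core_index_sets n m" by blast
  next
    fix x assume "x \<in> index_prod G g ` core_index_sets n m"
    then obtain A where A: "A \<in> core_index_sets n m" "x = index_prod G g A" by blast
    then have "finite A"
      by (auto simp: core_index_sets_def intro: finite_subset)
    then show "x \<in> core_gens G n m g"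
      using A cond[of "sorted_list_of_set A"]
      by (auto simp: core_gens_def core_index_sets_def index_prod_def
          intro!: exI[of _ "sorted_list_of_set A"])
  qed
qed


text \<open>The sizes 0, 1 and 2 contribute the corresponding binomial coefficients.\<close>

lemma card_small_subsets: "card {A. A \<subseteq> {1..k} \<and> card A \<le> 2} = 1 + k + k * (k - 1) div 2"
proof -
  let ?S = "\<lambda>j. {A. A \<subseteq> {1..k} \<and> card A = j}"
  have fin: "finite (?S j)" for j
    by (rule finite_subset[of _ "Pow {1..k}"]) auto
  have disj: "?S i \<inter> ?S j = {}" if "i \<noteq> j" for i j
    using that by blast
  have "c \<le> 2 \<longleftrightarrow> (c = 0 \<or> c = 1) \<or> c = 2" for c :: nat
    by linarith
  then have eq: "{A. A \<subseteq> {1..k} \<and> card A \<le> 2} = (?S 0 \<union> ?S 1) \<union> ?S 2"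
    by blast
  have "(?S 0 \<union> ?S 1) \<inter> ?S 2 = {}"
    unfolding Int_Un_distrib2 using disj[of 0 2] disj[of 1 2] by simp
  then have "card ((?S 0 \<union> ?S 1) \<union> ?S 2) = card (?S 0 \<union> ?S 1) + card (?S 2)"
    by (rule card_Un_disjoint[OF finite_UnI[OF fin fin] fin])
  moreover have "card (?S 0 \<union> ?S 1) = card (?S 0) + card (?S 1)"
    by (rule card_Un_disjoint[OF fin fin disj]) simp
  moreover have "card (?S j) = k choose j" for j
    by (simp add: n_subsets)
  ultimately show ?thesis
    unfolding eq by (simp only: choose_two binomial_n_0 choose_one)
qed

lemma finite_core_index_sets: "finite (core_index_sets n m)"
  by (rule finite_subset[of _ "Pow {1..n}"]) (auto simp: core_index_sets_def)

text \<open>Inclusion-exclusion for \<open>Pow {1..m}\<close> and the subsets of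
  \<open>{1..n}\<close> with at most two elements. Their intersection consists of the small subsets
  of \<open>{1..m}\<close>, whose number is the subtracted term.\<close>

lemma card_core_index_sets:
  assumes "m \<le> n"
  shows "card (core_index_sets n m) = core_gen_bound n m"
proof -
  let ?S = "\<lambda>k. {A. A \<subseteq> {1..k} \<and> card A \<le> 2}"
  have fin: "finite (?S n)"
    by (rule finite_subset[of _ "Pow {1..n}"]) auto
  have "{1..m} \<subseteq> {1..n}"
    using assms by simp
  then have "core_index_sets n m = Pow {1..m} \<union> ?S n" "?S m = Pow {1..m} \<inter> ?S n"
    unfolding core_index_sets_def by blast+
  then have "card (Pow {1..m}) + card (?S n) = card (core_index_sets n m) + card (?S m)"
    using card_Un_Int[OF _ fin, of "Pow {1..m}"] by (simp only: finite_Pow_iff finite_atLeastAtMost)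
  then have "card (core_index_sets n m) = card (?S n) + card (Pow {1..m}) - card (?S m)"
    by linarith
  then show ?thesis
    by (simp only: card_small_subsets core_gen_bound_def card_Pow finite_atLeastAtMost
        card_atLeastAtMost diff_Suc_1)
qed

text \<open>The arithmetic inequality is read off from the counted family, which lies in
  \<open>Pow {1..n}\<close>.\<close>

lemma core_gen_bound_le:
  assumes "m \<le> n"
  shows "core_gen_bound n m \<le> 2 ^ n"
proof -
  have "card (core_index_sets n m) \<le> card (Pow {1..n})"
    by (rule card_mono) (auto simp: core_index_sets_def)
  then show ?thesis
    by (simp add: card_core_index_sets[OF assms] card_Pow)
qed

section \<open>Algebra of ordered products, and elementary abelian 2-groups\<close>

lemma (in group) foldr_mult_append:
  assumes "set xs \<subseteq> carrier G" "set ys \<subseteq> carrier G"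
  shows "foldr (\<otimes>) (xs @ ys) \<one> = foldr (\<otimes>) xs \<one> \<otimes> foldr (\<otimes>) ys \<one>"
  using assms by (induction xs) (simp_all add: m_assoc)

lemma (in group) foldr_mult_in_subgroup:
  assumes "subgroup H G" "set xs \<subseteq> H"
  shows "foldr (\<otimes>) xs \<one> \<in> H"
  using assms(2)
  by (induction xs) (auto simp: subgroup.one_closed[OF assms(1)] subgroup.m_closed[OF assms(1)])

lemma (in group) index_prod_closed:
  assumes "finite A" "g ` A \<subseteq> carrier G"
  shows "index_prod G g A \<in> carrier G"
  using assms by (simp add: index_prod_def)

lemma (in group_hom) hom_index_prod:
  assumes "finite A" "g ` A \<subseteq> carrier G"
  shows "h (index_prod G g A) = index_prod H (\<lambda>i. h (g i)) A"
proof -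
  have "h (foldr (\<otimes>) (map g is) \<one>) = foldr (\<otimes>\<^bsub>H\<^esub>) (map (\<lambda>i. h (g i)) is) \<one>\<^bsub>H\<^esub>"
    if "set is \<subseteq> A" for "is"
    using that assms(2)
  proof (induction "is")
    case (Cons i "is")
    then have "foldr (\<otimes>) (map g is) \<one> \<in> carrier G" "g i \<in> carrier G"
      by (auto intro!: G.multlist_closed simp: image_subset_iff subset_iff)
    with Cons show ?case by simp
  qed simp
  then show ?thesis
    using assms(1) by (simp add: index_prod_def)
qed

text \<open>Passing to \<open>finprod\<close> allows an index to be inserted or removed at any place
  of the product.\<close>

lemma (in comm_group) index_prod_conv_finprod:
  assumes "finite A" "g ` A \<subseteq> carrier G"
  shows "index_prod G g A = finprod G g A"
proof -
  have "foldr (\<otimes>) (map g is) \<one> = finprod G g (set is)" if "distinct is" "set is \<subseteq> A" for "is"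
    using that
  proof (induction "is")
    case (Cons i "is")
    then have "g \<in> set is \<rightarrow> carrier G" "g i \<in> carrier G"
      using assms(2) by auto
    with Cons show ?case by simp
  qed simp
  then show ?thesis
    using assms(1) by (simp add: index_prod_def)
qed

text \<open>Every element is its own inverse, so
  \<open>x y = (x y)^-1 = y^-1 x^-1 = y x\<close>.\<close>

lemma (in group) comm_group_if_exponent_two:
  assumes "\<And>x. x \<in> carrier G \<Longrightarrow> x \<otimes> x = \<one>"
  shows "comm_group G"
proof (rule group_comm_groupI)
  have inv: "inv x = x" if "x \<in> carrier G" for x
    using assms[OF that] that by (simp add: inv_equality)
  fix x y assume "x \<in> carrier G" "y \<in> carrier G"
  then show "x \<otimes> y = y \<otimes> x"
    using inv[of "x \<otimes> y"] inv[of x] inv[of y] by (simp add: inv_mult_group)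
qed

text \<open>Multiplying a subset product by \<open>g i\<close> toggles the membership of
  \<open>i\<close>, because a repeated factor squares to \<open>\<one>\<close>. The subset products
  are therefore stable under the group, and they contain \<open>\<one>\<close>.\<close>

lemma (in group) carrier_conv_index_prod:
  assumes exp: "\<And>x. x \<in> carrier G \<Longrightarrow> x \<otimes> x = \<one>"
    and gen: "generates_group G (g ` I)" and fin: "finite I"
  shows "carrier G = index_prod G g ` Pow I"
proof -
  interpret comm_group G
    by (rule comm_group_if_exponent_two[OF exp])
  have g: "g ` I \<subseteq> carrier G" and eq: "carrier G = generate G (g ` I)"
    using gen by (simp_all add: generates_group_def)
  define P where "P = finprod G g ` Pow I"
  have P: "index_prod G g ` Pow I = P"
    unfolding P_def using fin g
    by (intro image_cong refl index_prod_conv_finprod) (auto intro: finite_subset)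
  have Pc: "P \<subseteq> carrier G"
    using g by (auto simp: P_def intro!: finprod_closed)
  have step: "g i \<otimes> p \<in> P" if i: "i \<in> I" and p: "p \<in> P" for i p
  proof -
    obtain A where A: "A \<subseteq> I" "p = finprod G g A"
      using p by (auto simp: P_def)
    have fA: "finite A" using A fin finite_subset by blast
    have gA: "g \<in> A \<rightarrow> carrier G" "g i \<in> carrier G" using A g i by auto
    show ?thesis
    proof (cases "i \<in> A")
      case True
      have "p = finprod G g (insert i (A - {i}))"
        using True A by (simp add: insert_absorb)
      also have "\<dots> = g i \<otimes> finprod G g (A - {i})"
        using fA gA by (subst finprod_insert) auto
      finally have "g i \<otimes> p = (g i \<otimes> g i) \<otimes> finprod G g (A - {i})"
        using gA by (subst m_assoc) (auto intro!: finprod_closed)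
      also have "\<dots> = finprod G g (A - {i})"
        using gA exp by (auto intro!: finprod_closed l_one)
      finally show ?thesis
        using A by (auto simp: P_def)
    next
      case False
      then have "g i \<otimes> p = finprod G g (insert i A)"
        using fA gA A by simp
      then show ?thesis
        using A i by (auto simp: P_def)
    qed
  qed
  have "x \<otimes> p \<in> P" if "x \<in> generate G (g ` I)" "p \<in> P" for x p
    using that
  proof (induction arbitrary: p)
    case (inv x)
    then have "inv x = x"
      using exp g by (auto intro: inv_equality)
    then show ?case
      using inv step by auto
  next
    case (eng x y)
    then have "x \<otimes> y \<otimes> p = x \<otimes> (y \<otimes> p)"
      using generate_in_carrier[OF g] Pc by (intro m_assoc) auto
    then show ?case
      using eng by simp
  qed (use Pc step in auto)
  moreover have "\<one> \<in> P"
    by (auto simp: P_def intro!: image_eqI[of _ _ "{}"])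
  ultimately have "x \<in> P" if "x \<in> carrier G" for x
    using that eq r_one by metis
  then show ?thesis
    using P Pc by auto
qed

text \<open>If two products agree and \<open>i\<close> lies in only one of the index sets, then
  \<open>g i\<close> occurs exactly once in the equation. Solving for it expresses
  \<open>g i\<close> by the other generators, without any commutativity.\<close>

lemma (in group) inj_on_index_prod:
  assumes fin: "finite I" and g: "g ` I \<subseteq> carrier G"
    and irred: "\<And>i. i \<in> I \<Longrightarrow> g i \<notin> generate G (g ` (I - {i}))"
  shows "inj_on (index_prod G g) (Pow I)"
proof -
  have sub: "A \<subseteq> B"
    if A: "A \<subseteq> I" and B: "B \<subseteq> I" and eq: "index_prod G g A = index_prod G g B" for A B
  proof (rule ccontr)
    assume "\<not> A \<subseteq> B"
    then obtain i where i: "i \<in> A" "i \<notin> B" by blast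
    define H where "H = generate G (g ` (I - {i}))"
    have H: "subgroup H G"
      unfolding H_def by (rule generate_is_subgroup) (use g in auto)
    have gH: "g j \<in> H" if "j \<in> I" "j \<noteq> i" for j
      unfolding H_def using that by (auto intro: generate.incl)
    have finAB: "finite A" "finite B"
      using A B fin finite_subset by blast+
    \<comment> \<open>Cut the product at its only factor \<open>g i\<close>; the parts on either
      side, like the product over \<open>B\<close>, lie in \<open>H\<close>.\<close>
    obtain xs ys where xy: "sorted_list_of_set A = xs @ i # ys"
      using i(1) finAB split_list[of i "sorted_list_of_set A"] by auto
    have dist: "i \<notin> set xs" "i \<notin> set ys" and setA: "set xs \<subseteq> A" "set ys \<subseteq> A"
      using distinct_sorted_list_of_set[of A] set_sorted_list_of_set[OF finAB(1)]
      unfolding xy by auto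
    define a where "a = foldr (\<otimes>) (map g xs) \<one>"
    define b where "b = foldr (\<otimes>) (map g ys) \<one>"
    have ab: "a \<in> H" "b \<in> H"
      unfolding a_def b_def using dist subset_trans[OF setA(1) A] subset_trans[OF setA(2) A]
      by (auto intro!: foldr_mult_in_subgroup[OF H] gH)
    have c: "index_prod G g B \<in> H"
      unfolding index_prod_def using i B finAB by (auto intro!: foldr_mult_in_subgroup[OF H] gH)
    have gi: "g i \<in> carrier G"
      using i A g by auto
    have "set (map g xs) \<subseteq> carrier G" "set (map g ys) \<subseteq> carrier G"
      using image_mono[OF subset_trans[OF setA(1) A], of g]
        image_mono[OF subset_trans[OF setA(2) A], of g] g by simp_all
    then have "index_prod G g A = a \<otimes> (g i \<otimes> b)"
      unfolding index_prod_def xy map_append a_def b_def using gi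
      by (subst foldr_mult_append) simp_all
    then have "g i = inv a \<otimes> index_prod G g B \<otimes> inv b"
      using ab[THEN subgroup.mem_carrier[OF H]] gi by (simp add: m_assoc flip: eq)
    also have "\<dots> \<in> H"
      using ab c by (intro subgroup.m_closed[OF H] subgroup.m_inv_closed[OF H])
    finally show False
      using irred i A unfolding H_def by blast
  qed
  show ?thesis
  proof (rule inj_onI)
    fix A B assume "A \<in> Pow I" "B \<in> Pow I" "index_prod G g A = index_prod G g B"
    then show "A = B"
      using sub[of A B] sub[of B A] by auto
  qed
qed

section \<open>Ranks\<close>

lemma ecard_image_le:
  assumes "finite A"
  shows "ecard (f ` A) \<le> enat (card A)"
  using assms by (simp add: ecard_def card_image_le)

lemma gen_group_le:
  assumes "generates_group G S"
  shows "gen_group G \<le> ecard S"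
  using assms by (auto simp: gen_group_def intro: INF_lower)

lemma gen_quandle_le:
  assumes "generates_quandle Q S"
  shows "gen_quandle Q \<le> ecard S"
  using assms by (auto simp: gen_quandle_def intro: INF_lower)

lemma gen_group_eq_enatE:
  assumes "gen_group G = enat n"
  obtains h where "generates_group G (h ` {1..n})"
proof -
  define E where "E = ecard ` {S. generates_group G S}"
  have E: "Inf E = enat n"
    using assms by (simp add: gen_group_def E_def)
  \<comment> \<open>The infimum of the empty set is \<open>\<infinity>\<close>; on a nonempty set of
    \<open>enat\<close> the infimum is a least element, hence attained.\<close>
  then have "E \<noteq> {}"
    by (auto simp: Inf_enat_def)
  then have "Inf E \<in> E"
    unfolding Inf_enat_def by (metis (mono_tags, lifting) LeastI all_not_in_conv)
  then obtain S where S: "generates_group G S" "ecard S = enat n"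
    using E by (auto simp: E_def)
  then have "finite S" "card S = n"
    by (auto simp: ecard_def split: if_splits)
  then obtain h where "bij_betw h {1..n} S"
    using ex_bij_betw_nat_finite_1 by blast
  then have "h ` {1..n} = S"
    by (simp add: bij_betw_def)
  with S that show thesis by blast
qed

lemma (in group) generates_group_remove:
  assumes gen: "generates_group G (g ` I)" and i: "g i \<in> generate G (g ` (I - {i}))"
  shows "generates_group G (g ` (I - {i}))"
proof -
  have g: "g ` I \<subseteq> carrier G"
    using gen by (simp add: generates_group_def)
  have H: "subgroup (generate G (g ` (I - {i}))) G"
    by (rule generate_is_subgroup) (use g in auto)
  have "g ` I \<subseteq> generate G (g ` (I - {i}))"
    using i by (auto intro: generate.incl)
  then have "generate G (g ` I) \<subseteq> generate G (g ` (I - {i}))"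
    by (rule generate_subgroup_incl[OF _ H])
  then show ?thesis
    using gen subgroup.subset[OF H] by (auto simp: generates_group_def)
qed

text \<open>Dropping a redundant index would leave a generating family with fewer indices. As
  indices are removed rather than values, repeated generators are excluded too.\<close>

lemma (in group) irredundant_if_gen_group_eq_card:
  assumes "gen_group G = enat (card I)" "finite I" "generates_group G (g ` I)" "i \<in> I"
  shows "g i \<notin> generate G (g ` (I - {i}))"
proof
  assume "g i \<in> generate G (g ` (I - {i}))"
  then have "gen_group G \<le> ecard (g ` (I - {i}))"
    by (intro gen_group_le generates_group_remove[OF assms(3)])
  also have "\<dots> \<le> enat (card (I - {i}))"
    using assms(2) by (intro ecard_image_le) simp
  finally have "card I \<le> card (I - {i})"
    by (simp add: assms(1))
  then show False
    using card_Diff1_less[OF assms(2,4)] by simp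
qed

text \<open>Invariance of dimension over the field with two elements, by counting: an irredundant
  family gives \<open>2 ^ card I\<close> distinct subset products, while \<open>m\<close> generators
  give at most \<open>2 ^ m\<close> elements. Minimality of \<open>m\<close> gives the other
  inequality.\<close>

lemma (in group) card_irredundant_exponent_two:
  fixes g :: "nat \<Rightarrow> 'a"
  assumes exp: "\<And>x. x \<in> carrier G \<Longrightarrow> x \<otimes> x = \<one>"
    and m: "gen_group G = enat m"
    and gen: "generates_group G (g ` I)" and fin: "finite I"
    and irred: "\<And>i. i \<in> I \<Longrightarrow> g i \<notin> generate G (g ` (I - {i}))"
  shows "card I = m"
proof (rule antisym)
  obtain h where h: "generates_group G (h ` {1..m})"
    using m by (rule gen_group_eq_enatE)
  have carrier: "carrier G = index_prod G h ` Pow {1..m}"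
    by (rule carrier_conv_index_prod[OF exp h]) auto
  have "2 ^ card I = card (index_prod G g ` Pow I)"
    using gen fin irred
    by (subst card_image) (auto simp: generates_group_def card_Pow intro!: inj_on_index_prod)
  also have "index_prod G g ` Pow I = carrier G"
    using carrier_conv_index_prod[OF exp gen fin] by simp
  also have "card \<dots> \<le> 2 ^ m"
    using card_image_le[of "Pow {1..m}" "index_prod G h"] by (simp add: carrier card_Pow)
  finally show "card I \<le> m" by simp
  have "gen_group G \<le> enat (card I)"
    using gen_group_le[OF gen] ecard_image_le[OF fin, of g] by (rule order_trans)
  then show "m \<le> card I"
    using m by simp
qed

section \<open>The factor group by the subgroup of squares\<close>

lemma (in group) exponent_two_Mod_squares:
  assumes "x \<in> carrier (G Mod squares_subgroup G)"
  shows "x \<otimes>\<^bsub>G Mod squares_subgroup G\<^esub> x = \<one>\<^bsub>G Mod squares_subgroup G\<^esub>"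
proof -
  interpret normal "squares_subgroup G" G
    by (rule squares_subgroup_normal)
  obtain y where y: "y \<in> carrier G" "x = squares_subgroup G #> y"
    using assms by (auto simp: carrier_FactGroup)
  then have "y \<otimes> y \<in> squares_subgroup G"
    by (auto simp: squares_subgroup_def intro: generate.incl)
  then show ?thesis
    using y by (simp add: rcos_sum coset_join2 is_subgroup)
qed

lemma (in group) gen_group_Mod_le:
  assumes "L \<lhd> G" "gen_group G = enat n"
  shows "gen_group (G Mod L) \<le> enat n"
proof -
  obtain h where "generates_group G (h ` {1..n})"
    using assms(2) by (rule gen_group_eq_enatE)
  then have "gen_group (G Mod L) \<le> ecard ((\<lambda>i. L #> h i) ` {1..n})"
    using generates_group_Mod[OF assms(1), of "h ` {1..n}"]
    by (intro gen_group_le) (simp add: image_image)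
  also have "\<dots> \<le> enat n"
    using ecard_image_le[of "{1..n}" "\<lambda>i. L #> h i"] by simp
  finally show ?thesis .
qed

text \<open>A subfamily of a minimal generating family maps to a basis of the elementary abelian
  \<open>2\<close>-group \<open>G Mod N\<close>; each remaining generator is divided by an element of the same coset
  in the subgroup generated by the subfamily.\<close>
lemma (in group) adapted_generators:
  assumes N: "N = squares_subgroup G"
    and n: "gen_group G = enat n" and m: "gen_group (G Mod N) = enat m"
  obtains g where "g \<in> {1..n} \<rightarrow> carrier G" "generates_group G (g ` {1..n})"
    "generates_group (G Mod N) ((\<lambda>i. N #> g i) ` {1..m})" "\<forall>i\<in>{m<..n}. g i \<in> N"
proof -
  have normal: "N \<lhd> G"
    unfolding N by (rule squares_subgroup_normal)
  interpret N: normal N G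
    by (rule normal)
  interpret M: group "G Mod N"
    by (rule N.factorgroup_is_group)
  interpret q: group_hom G "G Mod N" "\<lambda>x. N #> x"
    by (rule N.hom_rcos)
  obtain h where h: "generates_group G (h ` {1..n})"
    using n by (rule gen_group_eq_enatE)
  then have hc: "h i \<in> carrier G" if "i \<in> {1..n}" for i
    using that by (auto simp: generates_group_def)
  define P where
    "P I \<longleftrightarrow> I \<subseteq> {1..n} \<and> generates_group (G Mod N) ((\<lambda>i. N #> h i) ` I)" for I
  have "P {1..n}"
    using generates_group_Mod[OF normal h] by (simp add: P_def image_image)
  \<comment> \<open>A subfamily of least size whose images generate is irredundant, so it has
    exactly \<open>m\<close> members by the counting lemma.\<close>
  then obtain I where I: "P I" and min: "\<And>J. P J \<Longrightarrow> card I \<le> card J"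
    using ex_has_least_nat[of P "{1..n}" card] by blast
  have In: "I \<subseteq> {1..n}" and genI: "generates_group (G Mod N) ((\<lambda>i. N #> h i) ` I)"
    using I by (auto simp: P_def)
  have finI: "finite I"
    using In finite_subset by blast
  have irred: "N #> h i \<notin> generate (G Mod N) ((\<lambda>i. N #> h i) ` (I - {i}))" if i: "i \<in> I" for i
  proof
    assume "N #> h i \<in> generate (G Mod N) ((\<lambda>i. N #> h i) ` (I - {i}))"
    then have "P (I - {i})"
      using M.generates_group_remove[OF genI] In by (auto simp: P_def)
    then show False
      using min card_Diff1_less[OF finI i] by force
  qed
  have cardI: "card I = m"
    by (rule M.card_irredundant_exponent_two[OF exponent_two_Mod_squares[folded N] m genI finI irred])
  have mn: "m \<le> n"
    using card_mono[OF _ In] cardI by simp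
  have hI: "h ` I \<subseteq> carrier G"
    using In hc by blast
  have "\<exists>p. p \<in> generate G (h ` I) \<and> N #> p = N #> h i" if "i \<in> {1..n}" for i
  proof -
    have "N #> h i \<in> generate (G Mod N) ((\<lambda>x. N #> x) ` (h ` I))"
      using genI hc[OF that] by (simp add: generates_group_def image_image)
    then show ?thesis
      unfolding q.generate_img[OF hI] by force
  qed
  then obtain p where p: "\<And>i. i \<in> {1..n} \<Longrightarrow> p i \<in> generate G (h ` I)"
      and Np: "\<And>i. i \<in> {1..n} \<Longrightarrow> N #> p i = N #> h i"
    by metis
  have pc: "p i \<in> carrier G" if "i \<in> {1..n}" for i
    using p[OF that] generate_in_carrier[OF hI] by blast
  obtain a where a: "bij_betw a {1..m} I"
    using ex_bij_betw_nat_finite_1[OF finI] cardI by blast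
  have "card {m<..n} = card ({1..n} - I)"
    using card_Diff_subset[OF finI In] cardI by simp
  then obtain b where b: "bij_betw b {m<..n} ({1..n} - I)"
    using finite_same_card_bij[of "{m<..n}" "{1..n} - I"] by blast
  \<comment> \<open>\<open>a\<close> moves the basis to the places \<open>1..m\<close>, and
    \<open>b\<close> lists the other indices at \<open>m+1..n\<close>, where
    \<open>inv p (b j)\<close> brings the generator into \<open>N\<close>.\<close>
  define g where "g j = (if j \<le> m then h (a j) else h (b j) \<otimes> inv p (b j))" for j
  have aI: "a j \<in> I" if "j \<in> {1..m}" for j
    using a that by (auto simp: bij_betw_def)
  have bI: "b j \<in> {1..n}" if "j \<in> {m<..n}" for j
    using b that by (auto simp: bij_betw_def)
  have g: "g \<in> {1..n} \<rightarrow> carrier G"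
  proof
    fix j assume "j \<in> {1..n}"
    then show "g j \<in> carrier G"
      using aI[of j] bI[of j] In hc pc by (auto simp: g_def)
  qed
  have gN: "\<forall>j\<in>{m<..n}. g j \<in> N"
  proof
    fix j assume j: "j \<in> {m<..n}"
    then show "g j \<in> N"
      using N.rcos_eq_iff[OF hc[OF bI[OF j]] pc[OF bI[OF j]]] Np[OF bI[OF j]] by (simp add: g_def)
  qed
  have ga: "g j = h (a j)" if "j \<in> {1..m}" for j
    using that by (simp add: g_def)
  have "(\<lambda>j. N #> g j) ` {1..m} = (\<lambda>i. N #> h i) ` a ` {1..m}"
    unfolding image_image by (intro image_cong refl) (simp add: ga)
  also have "a ` {1..m} = I"
    using a by (simp add: bij_betw_def)
  finally have gm: "generates_group (G Mod N) ((\<lambda>j. N #> g j) ` {1..m})"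
    using genI by simp
  define H where "H = generate G (g ` {1..n})"
  have gc: "g ` {1..n} \<subseteq> carrier G"
    using g by blast
  have H: "subgroup H G"
    unfolding H_def by (rule generate_is_subgroup[OF gc])
  have gH: "g j \<in> H" if "j \<in> {1..n}" for j
    unfolding H_def using that by (blast intro: generate.incl)
  have hIH: "h ` I \<subseteq> H"
  proof clarify
    fix i assume "i \<in> I"
    then obtain j where j: "j \<in> {1..m}" "i = a j"
      using a by (auto simp: bij_betw_def)
    then show "h i \<in> H"
      using ga[of j] gH[of j] mn by simp
  qed
  have pH: "p i \<in> H" if "i \<in> {1..n}" for i
    using p[OF that] generate_subgroup_incl[OF hIH H] by blast
  have "h ` {1..n} \<subseteq> H"
  proof clarify
    fix i assume i: "i \<in> {1..n}"
    show "h i \<in> H"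
    proof (cases "i \<in> I")
      case True
      then show ?thesis using hIH by blast
    next
      case False
      then have "i \<in> b ` {m<..n}"
        using b i by (simp add: bij_betw_def)
      then obtain j where j: "j \<in> {m<..n}" "i = b j"
        by blast
      \<comment> \<open>The correction is undone inside \<open>H\<close>, since \<open>p i\<close>
        is a word in the basis elements, which \<open>g\<close> keeps.\<close>
      then have "h i = g j \<otimes> p i"
        using hc[OF i] pc[OF i] by (simp add: g_def m_assoc)
      then show ?thesis
        using gH[of j] pH[OF i] j subgroup.m_closed[OF H] by simp
    qed
  qed
  then have "generate G (h ` {1..n}) \<subseteq> H"
    by (rule generate_subgroup_incl[OF _ H])
  then have "generates_group G (g ` {1..n})"
    using h gc subgroup.subset[OF H] by (auto simp: generates_group_def H_def)
  with g gm gN that show thesis by blast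
qed

section \<open>Generating the core quandle\<close>

lemma (in group) generates_quandle_core_gens:
  assumes N: "N = squares_subgroup G" and mn: "m \<le> n"
    and gen: "generates_group G (g ` {1..n})"
    and genM: "generates_group (G Mod N) ((\<lambda>i. N #> g i) ` {1..m})"
  shows "generates_quandle (Core G) (core_gens G n m g)"
proof -
  have normal: "N \<lhd> G"
    unfolding N by (rule squares_subgroup_normal)
  interpret N: normal N G
    by (rule normal)
  interpret M: group "G Mod N"
    by (rule N.factorgroup_is_group)
  interpret q: group_hom G "G Mod N" "\<lambda>x. N #> x"
    by (rule N.hom_rcos)
  have gc: "g i \<in> carrier G" if "i \<in> {1..n}" for i
    using gen that by (auto simp: generates_group_def)
  have X: "core_gens G n m g = index_prod G g ` core_index_sets n m"
    by (rule core_gens_conv_index_prod)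
  have Xc: "core_gens G n m g \<subseteq> carrier G"
    unfolding X core_index_sets_def
    by (auto intro!: index_prod_closed gc intro: finite_subset)
  define Q where "Q = quandle_closure (Core G) (core_gens G n m g)"
  have XQ: "core_gens G n m g \<subseteq> Q"
    by (auto simp: Q_def intro: quandle_closure.incl)
  have op: "x \<otimes> inv y \<otimes> x \<in> Q" if "x \<in> Q" "y \<in> Q" for x y
    using quandle_closure.op[of x "Core G" _ y] that by (simp add: Q_def Core_def)
  have Q: "Q \<subseteq> carrier G"
  proof
    fix x assume "x \<in> Q"
    then show "x \<in> carrier G"
      unfolding Q_def by induction (use Xc in \<open>auto simp: Core_def\<close>)
  qed
  have memQ: "index_prod G g A \<in> Q" if "A \<in> core_index_sets n m" for A
    using that XQ X by blast
  have one: "\<one> \<in> Q"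
    using memQ[of "{}"] by (simp add: core_index_sets_def index_prod_def)
  have single: "g i \<in> Q" if "i \<in> {1..n}" for i
    using memQ[of "{i}"] gc[OF that] that by (simp add: core_index_sets_def index_prod_def)
  have pair: "g i \<otimes> g j \<in> Q" if "i \<in> {1..n}" "j \<in> {1..n}" "i < j" for i j
  proof -
    have "sorted_list_of_set {i, j} = [i, j]"
      using that(3) by (intro sorted_list_of_set_unique[THEN iffD1]) auto
    moreover have "{i, j} \<in> core_index_sets n m"
      using that by (simp add: core_index_sets_def)
    ultimately show ?thesis
      using memQ[of "{i, j}"] gc[OF that(1)] gc[OF that(2)] by (simp add: index_prod_def)
  qed
  \<comment> \<open>This is the core operation of \<open>x\<close> on \<open>\<one>\<close>. It
    supplies the product of a generator with itself, which no increasing list provides.\<close>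
  have square: "x \<otimes> x \<in> Q" if "x \<in> Q" for x
    using op[OF that one] that Q by auto
  have NL: "N \<subseteq> translation_stabilizer G Q"
    unfolding N
  proof (rule squares_subgroup_le_translation_stabilizer[OF Q op one gen])
    show "g ` {1..n} \<subseteq> Q"
      using single by blast
    fix x y assume "x \<in> g ` {1..n}" "y \<in> g ` {1..n}"
    then obtain i j where "i \<in> {1..n}" "j \<in> {1..n}" "x = g i" "y = g j"
      by blast
    then show "x \<otimes> y \<in> Q \<or> y \<otimes> x \<in> Q"
      using pair[of i j] pair[of j i] square[OF single[of i]] by (cases i j rule: linorder_cases) auto
  qed
  have "carrier G \<subseteq> Q"
  proof
    fix x assume x: "x \<in> carrier G"
    \<comment> \<open>Each coset of \<open>N\<close> is that of a product over some
      \<open>A \<subseteq> {1..m}\<close>, which is among the given elements. Left translation by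
      \<open>N\<close> then reaches the rest of the coset inside \<open>Q\<close>.\<close>
    have "carrier (G Mod N) = index_prod (G Mod N) (\<lambda>i. N #> g i) ` Pow {1..m}"
      using exponent_two_Mod_squares genM
      by (intro M.carrier_conv_index_prod) (auto simp: N)
    then obtain A where A: "A \<subseteq> {1..m}" "N #> x = index_prod (G Mod N) (\<lambda>i. N #> g i) A"
      using x q.hom_closed[of x] by auto
    then have An: "A \<subseteq> {1..n}" and fA: "finite A"
      using mn by (auto intro: finite_subset)
    have "A \<in> core_index_sets n m"
      using A An by (simp add: core_index_sets_def)
    then have pQ: "index_prod G g A \<in> Q"
      by (rule memQ)
    have "N #> x = N #> index_prod G g A"
      using A An fA gc by (subst q.hom_index_prod) auto
    then have "x \<otimes> inv (index_prod G g A) \<in> N"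
      using x pQ Q by (subst (asm) N.rcos_eq_iff) auto
    then have "(x \<otimes> inv (index_prod G g A)) \<otimes> index_prod G g A \<in> Q"
      using NL pQ by (auto simp: translation_stabilizer_def)
    moreover have "index_prod G g A \<in> carrier G"
      using pQ Q by blast
    ultimately show "x \<in> Q"
      using x by (simp add: m_assoc)
  qed
  with Q Xc show ?thesis
    by (simp add: generates_quandle_def Q_def Core_def)
qed

text \<open>Minimality of \<open>n\<close> already makes the products over all subsets of \<open>{1..n}\<close> distinct.\<close>
lemma (in group) ecard_core_gens:
  assumes n: "gen_group G = enat n" and gen: "generates_group G (g ` {1..n})" and mn: "m \<le> n"
  shows "ecard (core_gens G n m g) = enat (core_gen_bound n m)"
proof -
  have "inj_on (index_prod G g) (Pow {1..n})"
    using irredundant_if_gen_group_eq_card[of "{1..n}" g] n gen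
    by (intro inj_on_index_prod) (auto simp: generates_group_def)
  then have "inj_on (index_prod G g) (core_index_sets n m)"
    by (rule inj_on_subset) (auto simp: core_index_sets_def)
  then show ?thesis
    by (simp add: ecard_def core_gens_conv_index_prod card_image finite_core_index_sets
        card_core_index_sets[OF mn])
qed

theorem theorem8p2:
  fixes G :: "('a, 'b) monoid_scheme" and n :: nat and N :: "'a set"
  assumes "group G"
    and "gen_group G = enat n"
    and "N = squares_subgroup G"
  shows "gen_quandle (Core G) \<le> enat (2 ^ n)
    \<and> N \<lhd> G
    \<and> gen_group (G Mod N) \<le> enat n
    \<and> (\<forall>m. gen_group (G Mod N) = enat m \<longrightarrow>
          gen_quandle (Core G) \<le> enat (core_gen_bound n m)
        \<and> (\<forall>g. g \<in> {1..n} \<rightarrow> carrier G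
              \<and> generates_group G (g ` {1..n})
              \<and> generates_group (G Mod N) ((\<lambda>i. N #>\<^bsub>G\<^esub> g i) ` {1..m})
              \<and> (\<forall>i\<in>{m<..n}. g i \<in> N)
            \<longrightarrow> generates_quandle (Core G) (core_gens G n m g)
              \<and> ecard (core_gens G n m g) = enat (core_gen_bound n m)))"
proof -
  interpret group G by (rule assms(1))
  note n = assms(2) and N = assms(3)
  have normal: "N \<lhd> G"
    unfolding N by (rule squares_subgroup_normal)
  have le: "gen_group (G Mod N) \<le> enat n"
    by (rule gen_group_Mod_le[OF normal n])
  have gens: "generates_quandle (Core G) (core_gens G n m g)"
      "ecard (core_gens G n m g) = enat (core_gen_bound n m)"
    if "gen_group (G Mod N) = enat m" "generates_group G (g ` {1..n})"
      "generates_group (G Mod N) ((\<lambda>i. N #>\<^bsub>G\<^esub> g i) ` {1..m})" for m g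
  proof -
    have "m \<le> n"
      using le that(1) by simp
    then show "generates_quandle (Core G) (core_gens G n m g)"
        "ecard (core_gens G n m g) = enat (core_gen_bound n m)"
      using generates_quandle_core_gens[OF N _ that(2,3)] ecard_core_gens[OF n that(2)] by auto
  qed
  have bound: "gen_quandle (Core G) \<le> enat (core_gen_bound n m)"
    if m: "gen_group (G Mod N) = enat m" for m
  proof -
    obtain g where "generates_group G (g ` {1..n})"
        "generates_group (G Mod N) ((\<lambda>i. N #>\<^bsub>G\<^esub> g i) ` {1..m})"
      using N n m by (rule adapted_generators)
    from gens[OF m this] show ?thesis
      using gen_quandle_le by metis
  qed
  \<comment> \<open>The bound by \<open>n\<close> rules out an infinite rank of the factor group, so
    an \<open>m\<close> exists and the estimate \<open>2 ^ n\<close> follows from the sharper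
    one.\<close>
  obtain m where m: "gen_group (G Mod N) = enat m" "m \<le> n"
    using le by (cases "gen_group (G Mod N)") auto
  have "gen_quandle (Core G) \<le> enat (2 ^ n)"
    using bound[OF m(1)] core_gen_bound_le[OF m(2)] by (meson enat_ord_simps(1) order_trans)
  then show ?thesis
    using normal le bound gens by blast
qed

end
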